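(* Consider the nonsymmetric V-cycle hierarchy $(A_k,B_k,P_k,R_k,M_k)$ and the level-wise error propagation matrices $E_{k,+}$ (with one pre- and one post-smoothing step) defined in the context. Suppose there is $\alpha\in[0,1)$ such that for every level $k=0,\dots,L-1$ and all $e\in\mathbb{C}^{n_k}$ $$\|(I-(M_k^{-1}A_k)^+)e\|_{B_k}^2\le \alpha\,\|(I-\Pi_{A_k})e\|_{B_k}^2+\|\Pi_{A_k}e\|_{B_k}^2 .$$ Then $\|E_{k,+}\|_{B_k}\le\alpha$ for all levels $k=0,\dots,L$.
   Context: For a Hermitian positive definite (HPD) matrix $G\in\mathbb{C}^{m\times m}$: $\langle x,y\rangle_G=y^HGx$, $\|x\|_G=\sqrt{x^HGx}$, and for $C\in\mathbb{C}^{m\times m}$, $\|C\|_G=\sup_{x\ne0}\|Cx\|_G/\|x\|_G$. $\mathcal R(\cdot)$ denotes the range (column space). Hierarchy: let $A\in\mathbb{C}^{n\times n}$ be nonsingular, $B\in\mathbb{C}^{n\times n}$ HPD, $L\in\mathbb{N}$, and $n=n_0>n_1>\dots>n_L\ge 1$ integers. Set $A_0=A$, $B_0=B$. For $k=0,\dots,L-1$ let $R_k,P_k\in\mathbb{C}^{n_k\times n_{k+1}}$ have full column rank with $\mathcal R(P_k)=\mathcal R(B_k^{-1}A_k^HR_k)$, and set $A_{k+1}=R_k^HA_kP_k$, $B_{k+1}=P_k^HB_kP_k$ (then $A_{k+1}$ is nonsingular and $B_{k+1}$ is HPD). For $k=0,\dots,L-1$ put $\Pi_{A_k}=P_kA_{k+1}^{-1}R_k^HA_k$,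 and let $M_k^{-1}\in\mathbb{C}^{n_k\times n_k}$ be a nonsingular matrix (the smoother) satisfying $\|I-M_k^{-1}A_k\|_{B_k}<1$. On level $k$, $C^+=B_k^{-1}C^HB_k$ denotes the $B_k$-adjoint of $C\in\mathbb{C}^{n_k\times n_k}$. Error matrices: $E_{L,+}=0\in\mathbb{C}^{n_L\times n_L}$ and, for $k=L-1,\dots,0$, $$E_{k,+}=(I-(M_k^{-1}A_k)^+)\bigl(I-P_k(I-E_{k+1,+})A_{k+1}^{-1}R_k^HA_k\bigr)(I-M_k^{-1}A_k).$$ *)

theory Defs
  imports
    "Jordan_Normal_Form.Schur_Decomposition"
    "Jordan_Normal_Form.Gauss_Jordan_Elimination"
    "Jordan_Normal_Form.DL_Rank"
begin

text \<open>Total version of \<^const>\<open>mat_inverse\<close>; meaningful for nonsingular matrices only.\<close>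

definition mat_inv :: "complex mat \<Rightarrow> complex mat" where
  "mat_inv C = the (mat_inverse C)"

definition hpd :: "nat \<Rightarrow> complex mat \<Rightarrow> bool" where
  "hpd m G \<longleftrightarrow> G \<in> carrier_mat m m \<and> mat_adjoint G = G \<and>
     (\<forall>x \<in> carrier_vec m. x \<noteq> 0\<^sub>v m \<longrightarrow> 0 < Re ((G *\<^sub>v x) \<bullet>c x))"

text \<open>The second argument of \<open>\<bullet>c\<close> is conjugated, so \<open>(G *\<^sub>v x) \<bullet>c y\<close> is $y^H G x$.\<close>

definition inner_wrt :: "complex mat \<Rightarrow> complex vec \<Rightarrow> complex vec \<Rightarrow> complex" where
  "inner_wrt G x y = (G *\<^sub>v x) \<bullet>c y"

definition vnorm_wrt :: "complex mat \<Rightarrow> complex vec \<Rightarrow> real" where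
  "vnorm_wrt G x = sqrt (Re (inner_wrt G x x))"

definition mnorm_wrt :: "complex mat \<Rightarrow> complex mat \<Rightarrow> real" where
  "mnorm_wrt G C = (SUP x \<in> {x \<in> carrier_vec (dim_row G). x \<noteq> 0\<^sub>v (dim_row G)}.
                      vnorm_wrt G (C *\<^sub>v x) / vnorm_wrt G x)"

definition adjoint_wrt :: "complex mat \<Rightarrow> complex mat \<Rightarrow> complex mat" where
  "adjoint_wrt G C = mat_inv G * mat_adjoint C * G"

text \<open>All sequences are indexed by the level; values of \<open>n\<close>, \<open>A\<close>, \<open>B\<close> beyond level \<open>L\<close> and of
  \<open>R\<close>, \<open>P\<close>, \<open>Minv\<close> from level \<open>L\<close> on are irrelevant. The matrix \<open>Minv k\<close> is $M_k^{-1}$ itself.\<close>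

locale vcycle_hierarchy =
  fixes L :: nat
    and n :: "nat \<Rightarrow> nat"
    and A B R P Minv :: "nat \<Rightarrow> complex mat"
  assumes n_decreasing: "k < L \<Longrightarrow> n (Suc k) < n k"
    and n_coarsest: "1 \<le> n L"
    and A_0: "A 0 \<in> carrier_mat (n 0) (n 0)" "invertible_mat (A 0)"
    and B_0: "hpd (n 0) (B 0)"
    and R_carrier: "k < L \<Longrightarrow> R k \<in> carrier_mat (n k) (n (Suc k))"
    and P_carrier: "k < L \<Longrightarrow> P k \<in> carrier_mat (n k) (n (Suc k))"
    and R_full_rank: "k < L \<Longrightarrow> vec_space.rank (n k) (R k) = n (Suc k)"
    and P_full_rank: "k < L \<Longrightarrow> vec_space.rank (n k) (P k) = n (Suc k)"
    and range_P: "k < L \<Longrightarrow> vec_space.col_space (n k) (P k)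
           = vec_space.col_space (n k) (mat_inv (B k) * mat_adjoint (A k) * R k)"
    and A_Suc: "k < L \<Longrightarrow> A (Suc k) = mat_adjoint (R k) * A k * P k"
    and B_Suc: "k < L \<Longrightarrow> B (Suc k) = mat_adjoint (P k) * B k * P k"
    and Minv_carrier: "k < L \<Longrightarrow> Minv k \<in> carrier_mat (n k) (n k)"
    and Minv_nonsingular: "k < L \<Longrightarrow> invertible_mat (Minv k)"
    and smoother: "k < L \<Longrightarrow> mnorm_wrt (B k) (1\<^sub>m (n k) - Minv k * A k) < 1"

definition coarse_proj ::
  "(nat \<Rightarrow> complex mat) \<Rightarrow> (nat \<Rightarrow> complex mat) \<Rightarrow> (nat \<Rightarrow> complex mat) \<Rightarrow> nat \<Rightarrow> complex mat" where
  "coarse_proj A R P k = P k * mat_inv (A (Suc k)) * mat_adjoint (R k) * A k"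

text \<open>The error matrix $E_{k,+}$; the recursion runs from the coarsest level \<open>L\<close> down to \<open>k\<close>.\<close>

function vcycle_err ::
  "nat \<Rightarrow> (nat \<Rightarrow> nat) \<Rightarrow> (nat \<Rightarrow> complex mat) \<Rightarrow> (nat \<Rightarrow> complex mat) \<Rightarrow> (nat \<Rightarrow> complex mat) \<Rightarrow>
   (nat \<Rightarrow> complex mat) \<Rightarrow> (nat \<Rightarrow> complex mat) \<Rightarrow> nat \<Rightarrow> complex mat" where
  "vcycle_err L n A B R P Minv k =
     (if k < L then
        (1\<^sub>m (n k) - adjoint_wrt (B k) (Minv k * A k)) *
        (1\<^sub>m (n k) - P k * (1\<^sub>m (n (Suc k)) - vcycle_err L n A B R P Minv (Suc k))
                       * mat_inv (A (Suc k)) * mat_adjoint (R k) * A k) *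
        (1\<^sub>m (n k) - Minv k * A k)
      else 0\<^sub>m (n k) (n k))"
  by pat_completeness auto
termination
  by (relation "measure (\<lambda>(L, _, _, _, _, _, _, k). L - k)") auto

declare vcycle_err.simps [simp del]

end

theory Submission
  imports Defs
begin

text \<open>
  Fix a level, write \<open>\<langle>u, v\<rangle>\<close> and \<open>\<parallel>u\<parallel>\<close> for the inner product and norm of \<open>B\<close>, and let \<open>S\<close> be the
  error matrix of the smoother, \<open>T\<close> its \<open>B\<close>-adjoint and \<open>\<Pi>\<close> the coarse-level correction. The range
  condition that ties \<open>P\<close> to \<open>R\<close> says that the kernel of \<open>\<Pi>\<close>, the vectors \<open>r\<close> whose restricted residual
  \<open>R\<^sup>H A r\<close> vanishes, is the \<open>B\<close>-orthogonal complement of the range of \<open>P\<close>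
  (\<open>coarse_residual_orthogonal\<close>), so \<open>\<Pi>\<close> is an orthogonal projection. It also
  makes the coarse matrix nonsingular (\<open>coarse_matrix_trivial_kernel\<close>). By the Galerkin choice of the
  coarse inner product, \<open>P\<close> is an isometry from the next level.

  Let \<open>z = S x = r + p\<close> with \<open>p = \<Pi> z = P y\<close>. One cycle maps \<open>x\<close> to \<open>T (r + p')\<close> with \<open>p' = P E y\<close>, where
  \<open>E\<close> is the error matrix of the next level (\<open>vcycle_err_apply\<close>); inductively \<open>\<parallel>p'\<parallel> \<le> \<alpha> \<parallel>p\<parallel>\<close>. The
  smoothing hypothesis then gives \<open>\<parallel>T (r + p')\<parallel>\<^sup>2 \<le> \<alpha> \<parallel>r\<parallel>\<^sup>2 + \<alpha>\<^sup>2 \<parallel>p\<parallel>\<^sup>2 = \<alpha> q\<close> with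
  \<open>q = \<parallel>r\<parallel>\<^sup>2 + \<alpha> \<parallel>p\<parallel>\<^sup>2\<close>, and what remains is \<open>\<alpha> q \<le> \<alpha>\<^sup>2 \<parallel>x\<parallel>\<^sup>2\<close>. This bounds the pre-smoother \<open>S\<close>,
  whereas the hypothesis speaks of its adjoint, so a duality argument is needed: the weighted vector
  \<open>w = r + \<alpha> p\<close> satisfies \<open>\<langle>T w, x\<rangle> = \<langle>w, S x\<rangle> = q\<close>, and the hypothesis applied to \<open>w\<close> itself gives
  \<open>\<parallel>T w\<parallel>\<^sup>2 \<le> \<alpha> q\<close>. Expanding \<open>0 \<le> \<parallel>T w - \<alpha> x\<parallel>\<^sup>2\<close> yields the claim
  (\<open>smoothed_contraction\<close>). The weight \<open>\<alpha>\<close> on \<open>p\<close> is exactly the one for which the bound on \<open>T\<close> and the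
  contraction on the coarse level balance, so that \<open>\<alpha>\<close> does not grow with the number of levels.
\<close>

section \<open>Conjugate transposes and weighted inner products\<close>

lemma mat_adjoint_carrier [simp]:
  "M \<in> carrier_mat m c \<Longrightarrow> mat_adjoint M \<in> carrier_mat c m"
  unfolding mat_adjoint_def using mat_of_rows_carrier(1)[of "dim_row M" "map conjugate (cols M)"] by simp

lemma mat_adjoint_index:
  "M \<in> carrier_mat m c \<Longrightarrow> i < c \<Longrightarrow> j < m \<Longrightarrow> mat_adjoint M $$ (i, j) = conjugate (M $$ (j, i))"
  unfolding mat_adjoint_def by (simp add: mat_of_rows_index)

lemma mat_adjoint_adjoint:
  assumes "(M :: complex mat) \<in> carrier_mat m c"
  shows "mat_adjoint (mat_adjoint M) = M"
proof (rule eq_matI)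
  note M' = mat_adjoint_carrier[OF assms]
  note M'' = mat_adjoint_carrier[OF M']
  show "dim_row (mat_adjoint (mat_adjoint M)) = dim_row M" "dim_col (mat_adjoint (mat_adjoint M)) = dim_col M"
    using carrier_matD[OF M''] carrier_matD[OF assms] by auto
  fix i j assume "i < dim_row M" "j < dim_col M"
  then show "mat_adjoint (mat_adjoint M) $$ (i, j) = M $$ (i, j)"
    using carrier_matD[OF assms] by (simp add: mat_adjoint_index[OF M'] mat_adjoint_index[OF assms])
qed

lemma cscalar_prod_mat_adjoint:
  assumes M: "(M :: complex mat) \<in> carrier_mat m c" and x: "x \<in> carrier_vec c" and y: "y \<in> carrier_vec m"
  shows "(M *\<^sub>v x) \<bullet>c y = x \<bullet>c (mat_adjoint M *\<^sub>v y)"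
proof -
  have "(M *\<^sub>v x) \<bullet>c y = (\<Sum>i<m. \<Sum>j<c. M $$ (i, j) * x $ j * cnj (y $ i))"
    using assms by (auto simp: scalar_prod_def sum_distrib_right atLeast0LessThan intro!: sum.cong)
  also have "\<dots> = (\<Sum>j<c. \<Sum>i<m. M $$ (i, j) * x $ j * cnj (y $ i))"
    by (rule sum.swap)
  also have "\<dots> = x \<bullet>c (mat_adjoint M *\<^sub>v y)"
    using assms carrier_matD[OF mat_adjoint_carrier[OF M]]
    by (auto simp: scalar_prod_def sum_distrib_left atLeast0LessThan mat_adjoint_index[OF M] mult_ac
        intro!: sum.cong)
  finally show ?thesis .
qed

lemma cscalar_prod_mat_adjoint':
  assumes M: "(M :: complex mat) \<in> carrier_mat m c" and x: "x \<in> carrier_vec c" and y: "y \<in> carrier_vec m"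
  shows "(mat_adjoint M *\<^sub>v y) \<bullet>c x = y \<bullet>c (M *\<^sub>v x)"
  using cscalar_prod_mat_adjoint[OF mat_adjoint_carrier[OF M] y x] mat_adjoint_adjoint[OF M] by simp

lemma hpd_carrier: "hpd m G \<Longrightarrow> G \<in> carrier_mat m m"
  and hpd_adjoint: "hpd m G \<Longrightarrow> mat_adjoint G = G"
  by (auto simp: hpd_def)

lemma inner_wrt_add_left:
  assumes "hpd m G" "x \<in> carrier_vec m" "y \<in> carrier_vec m" "z \<in> carrier_vec m"
  shows "inner_wrt G (x + y) z = inner_wrt G x z + inner_wrt G y z"
  using assms hpd_carrier[OF assms(1)] unfolding inner_wrt_def
  by (simp add: mult_add_distrib_mat_vec[of _ m m] add_scalar_prod_distrib[of _ m])

lemma inner_wrt_smult_left: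
  assumes "hpd m G" "x \<in> carrier_vec m" "z \<in> carrier_vec m"
  shows "inner_wrt G (c \<cdot>\<^sub>v x) z = c * inner_wrt G x z"
  using assms hpd_carrier[OF assms(1)] unfolding inner_wrt_def
  by (simp add: mult_mat_vec[of _ m m])

lemma inner_wrt_commute:
  assumes "hpd m G" "x \<in> carrier_vec m" "y \<in> carrier_vec m"
  shows "inner_wrt G y x = cnj (inner_wrt G x y)"
proof -
  have G: "G \<in> carrier_mat m m" using assms(1) by (rule hpd_carrier)
  then have Gx: "G *\<^sub>v x \<in> carrier_vec m" using assms by simp
  have "inner_wrt G y x = y \<bullet>c (G *\<^sub>v x)"
    unfolding inner_wrt_def
    using cscalar_prod_mat_adjoint[OF G assms(3) assms(2)] hpd_adjoint[OF assms(1)] by simp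
  also have "\<dots> = conjugate (conjugate y \<bullet> (G *\<^sub>v x))"
    using conjugate_conjugate_sprod[OF assms(3) Gx] by simp
  also have "conjugate y \<bullet> (G *\<^sub>v x) = inner_wrt G x y"
    unfolding inner_wrt_def using conjugate_vec_sprod_comm[OF Gx assms(3)] by simp
  finally show ?thesis by simp
qed

lemma inner_wrt_add_right:
  assumes "hpd m G" "x \<in> carrier_vec m" "y \<in> carrier_vec m" "z \<in> carrier_vec m"
  shows "inner_wrt G x (y + z) = inner_wrt G x y + inner_wrt G x z"
  using assms
  by (simp add: inner_wrt_commute[OF assms(1) _ assms(2)] inner_wrt_add_left[of m])

lemma inner_wrt_smult_right:
  assumes "hpd m G" "x \<in> carrier_vec m" "y \<in> carrier_vec m"
  shows "inner_wrt G x (c \<cdot>\<^sub>v y) = cnj c * inner_wrt G x y"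
  using assms
  by (simp add: inner_wrt_commute[OF assms(1) _ assms(2)] inner_wrt_smult_left[of m])

lemma inner_wrt_self_pos:
  assumes "hpd m G" "x \<in> carrier_vec m" "x \<noteq> 0\<^sub>v m"
  shows "0 < Re (inner_wrt G x x)"
  using assms by (auto simp: hpd_def inner_wrt_def)

lemma inner_wrt_self_nonneg:
  assumes "hpd m G" "x \<in> carrier_vec m"
  shows "0 \<le> Re (inner_wrt G x x)"
  using inner_wrt_self_pos[OF assms] hpd_carrier[OF assms(1)] assms(2)
  by (cases "x = 0\<^sub>v m") (auto simp: inner_wrt_def)

lemma vnorm_wrt_sq:
  assumes "hpd m G" "x \<in> carrier_vec m"
  shows "(vnorm_wrt G x)\<^sup>2 = Re (inner_wrt G x x)"
  using inner_wrt_self_nonneg[OF assms] by (simp add: vnorm_wrt_def)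

lemma vnorm_wrt_sq_add:
  assumes "hpd m G" "x \<in> carrier_vec m" "y \<in> carrier_vec m"
  shows "(vnorm_wrt G (x + y))\<^sup>2 = (vnorm_wrt G x)\<^sup>2 + (vnorm_wrt G y)\<^sup>2 + 2 * Re (inner_wrt G x y)"
  using assms inner_wrt_commute[OF assms]
  by (simp add: vnorm_wrt_sq[of m] inner_wrt_add_left[of m] inner_wrt_add_right[of m])

lemma vnorm_wrt_sq_smult:
  assumes "hpd m G" "x \<in> carrier_vec m"
  shows "(vnorm_wrt G (complex_of_real t \<cdot>\<^sub>v x))\<^sup>2 = t\<^sup>2 * (vnorm_wrt G x)\<^sup>2"
proof -
  have tx: "complex_of_real t \<cdot>\<^sub>v x \<in> carrier_vec m" using assms(2) by simp
  show ?thesis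
    unfolding vnorm_wrt_sq[OF assms] vnorm_wrt_sq[OF assms(1) tx]
      inner_wrt_smult_left[OF assms(1,2) tx] inner_wrt_smult_right[OF assms(1,2,2)]
    by (simp add: power2_eq_square)
qed

text \<open>
  The supremum is taken over nonzero vectors only. In dimension zero it would be the supremum of the
  empty set of reals, whose value is unspecified; hence the positive dimension.
\<close>

lemma mnorm_wrt_le:
  assumes G: "hpd m G" and "0 < m"
    and bound: "\<And>x. x \<in> carrier_vec m \<Longrightarrow> vnorm_wrt G (C *\<^sub>v x) \<le> a * vnorm_wrt G x"
  shows "mnorm_wrt G C \<le> a"
proof -
  have dim: "dim_row G = m" using hpd_carrier[OF G] by simp
  have "unit_vec m 0 \<noteq> (0\<^sub>v m :: complex vec)" using \<open>0 < m\<close> by simp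
  then have "{x :: complex vec. x \<in> carrier_vec m \<and> x \<noteq> 0\<^sub>v m} \<noteq> {}"
    using unit_vec_carrier[of m 0] by blast
  then show ?thesis
    unfolding mnorm_wrt_def dim
  proof (rule cSUP_least)
    fix x :: "complex vec" assume "x \<in> {x \<in> carrier_vec m. x \<noteq> 0\<^sub>v m}"
    then have x: "x \<in> carrier_vec m" "x \<noteq> 0\<^sub>v m" by auto
    then have "0 < vnorm_wrt G x" using inner_wrt_self_pos[OF G] by (simp add: vnorm_wrt_def)
    then show "vnorm_wrt G (C *\<^sub>v x) / vnorm_wrt G x \<le> a"
      using bound[OF x(1)] by (simp add: divide_le_eq)
  qed
qed

section \<open>Inverses, full column rank and adjoints\<close>

lemma mat_inv_of_trivial_kernel:
  assumes M: "M \<in> carrier_mat m m"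
    and ker: "\<And>x. x \<in> carrier_vec m \<Longrightarrow> M *\<^sub>v x = 0\<^sub>v m \<Longrightarrow> x = 0\<^sub>v m"
  shows "mat_inv M \<in> carrier_mat m m" "M * mat_inv M = 1\<^sub>m m" "mat_inv M * M = 1\<^sub>m m"
proof -
  have "det M \<noteq> 0" using det_0_iff_vec_prod_zero_field[OF M] ker by blast
  then have "mat_inverse M \<noteq> None"
    using det_non_zero_imp_unit[OF M, where b = "()"] mat_inverse(1)[OF M, where b = "()"] by blast
  then have "mat_inverse M = Some (mat_inv M)" by (auto simp: mat_inv_def)
  from mat_inverse(2)[OF M this]
  show "mat_inv M \<in> carrier_mat m m" "M * mat_inv M = 1\<^sub>m m" "mat_inv M * M = 1\<^sub>m m" by auto
qed

lemma hpd_mat_inv: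
  assumes "hpd m G"
  shows "mat_inv G \<in> carrier_mat m m" "G * mat_inv G = 1\<^sub>m m"
proof -
  have "x = 0\<^sub>v m" if "x \<in> carrier_vec m" "G *\<^sub>v x = 0\<^sub>v m" for x
    using inner_wrt_self_pos[OF assms that(1)] that by (auto simp: inner_wrt_def)
  from mat_inv_of_trivial_kernel[OF hpd_carrier[OF assms] this]
  show "mat_inv G \<in> carrier_mat m m" "G * mat_inv G = 1\<^sub>m m" by auto
qed

text \<open>
  The rank counts columns as a set, so a repeated column has to be excluded first: it would leave
  fewer than \<open>c\<close> distinct columns, and the rank could not reach \<open>c\<close>.
\<close>

lemma full_column_rank_trivial_kernel:
  assumes M: "(M :: complex mat) \<in> carrier_mat m c" and rank: "vec_space.rank m M = c"
    and x: "x \<in> carrier_vec c" and Mx: "M *\<^sub>v x = 0\<^sub>v m"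
  shows "x = 0\<^sub>v c"
proof (rule ccontr)
  assume nz: "x \<noteq> 0\<^sub>v c"
  interpret vec_space "TYPE(complex)" m .
  have distinct: "distinct (cols M)"
  proof (rule ccontr)
    assume "\<not> distinct (cols M)"
    then have "card (set (cols M)) < c"
      using M card_distinct[of "cols M"] card_length[of "cols M"] by fastforce
    moreover obtain U where U: "maximal U (\<lambda>T. T \<subseteq> set (cols M) \<and> lin_indpt T)"
      using maximal_exists[of "(\<lambda>T. T \<subseteq> set (cols M) \<and> lin_indpt T)" "card (set (cols M))" "{}"]
      by (meson List.finite_set card_mono empty_iff empty_subsetI finite_lin_indpt2 rev_finite_subset)
    moreover have "card U \<le> card (set (cols M))"
      using U by (simp add: card_mono maximal_def)
    ultimately show False using rank_card_indpt[OF M U] rank by simp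
  qed
  show False
    using lin_depI[OF M x nz Mx distinct] full_rank_lin_indpt[OF M rank distinct] by blast
qed

lemma adjoint_wrt_carrier:
  assumes "hpd m G" "C \<in> carrier_mat m m"
  shows "adjoint_wrt G C \<in> carrier_mat m m"
  unfolding adjoint_wrt_def
  by (intro mult_carrier_mat[of _ m m] hpd_mat_inv(1) hpd_carrier mat_adjoint_carrier assms)

lemma inner_wrt_adjoint_wrt:
  assumes G: "hpd m G" and C: "C \<in> carrier_mat m m"
    and u: "u \<in> carrier_vec m" and x: "x \<in> carrier_vec m"
  shows "inner_wrt G (adjoint_wrt G C *\<^sub>v u) x = inner_wrt G u (C *\<^sub>v x)"
proof -
  note G' = hpd_carrier[OF G] and I = hpd_mat_inv(1)[OF G] and C' = mat_adjoint_carrier[OF C]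
  have Gu: "G *\<^sub>v u \<in> carrier_vec m" using G' u by simp
  have CGu: "mat_adjoint C *\<^sub>v (G *\<^sub>v u) \<in> carrier_vec m" using C' Gu by simp
  have "adjoint_wrt G C *\<^sub>v u = mat_inv G *\<^sub>v (mat_adjoint C *\<^sub>v (G *\<^sub>v u))"
    unfolding adjoint_wrt_def assoc_mult_mat_vec[OF mult_carrier_mat[OF I C'] G' u]
      assoc_mult_mat_vec[OF I C' Gu] ..
  then have "G *\<^sub>v (adjoint_wrt G C *\<^sub>v u) = mat_adjoint C *\<^sub>v (G *\<^sub>v u)"
    using assoc_mult_mat_vec[OF G' I CGu] hpd_mat_inv(2)[OF G] one_mult_mat_vec[OF CGu] by metis
  then show ?thesis
    unfolding inner_wrt_def using cscalar_prod_mat_adjoint'[OF C x Gu] by metis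
qed

lemma inner_wrt_one_minus_adjoint_wrt:
  assumes G: "hpd m G" and C: "C \<in> carrier_mat m m"
    and u: "u \<in> carrier_vec m" and x: "x \<in> carrier_vec m"
  shows "inner_wrt G ((1\<^sub>m m - adjoint_wrt G C) *\<^sub>v u) x = inner_wrt G u ((1\<^sub>m m - C) *\<^sub>v x)"
proof -
  have minus: "(1\<^sub>m m - D) *\<^sub>v v = v + (- 1) \<cdot>\<^sub>v (D *\<^sub>v v)" "D *\<^sub>v v \<in> carrier_vec m"
    if "D \<in> carrier_mat m m" "v \<in> carrier_vec m" for D :: "complex mat" and v
    using that minus_mult_distrib_mat_vec[OF one_carrier_mat that] by auto
  note Du = minus[OF adjoint_wrt_carrier[OF G C] u] and Cx = minus[OF C x]
  have s: "(- 1) \<cdot>\<^sub>v v \<in> carrier_vec m" if "v \<in> carrier_vec m" for v :: "complex vec"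
    using that by simp
  show ?thesis
    unfolding Du(1) Cx(1) inner_wrt_add_left[OF G u s[OF Du(2)] x] inner_wrt_add_right[OF G u x s[OF Cx(2)]]
      inner_wrt_smult_left[OF G Du(2) x] inner_wrt_smult_right[OF G u Cx(2)] inner_wrt_adjoint_wrt[OF assms]
    by simp
qed

section \<open>One level of the cycle\<close>

text \<open>
  The analytic core, with the matrices abstracted away: \<open>r + p\<close> is the orthogonal splitting of the
  pre-smoothed error of \<open>x\<close>, \<open>p'\<close> replaces \<open>p\<close> after the inexact coarse correction, and \<open>T\<close> is the
  post-smoother, which only has to be adjoint to the pre-smoother at \<open>x\<close>. The smoothing property is
  used at two vectors, at \<open>r + p'\<close> for the output of the cycle and at \<open>r + a p\<close> to bound, by duality,
  the pre-smoothed error by \<open>x\<close>.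
\<close>

lemma smoothed_contraction:
  assumes G: "hpd m G" and a: "0 \<le> a"
    and T: "T \<in> carrier_mat m m"
    and carrier: "x \<in> carrier_vec m" "r \<in> carrier_vec m" "p \<in> carrier_vec m" "p' \<in> carrier_vec m"
    and adj: "\<And>u. u \<in> carrier_vec m \<Longrightarrow> inner_wrt G (T *\<^sub>v u) x = inner_wrt G u (r + p)"
    and orth: "inner_wrt G r p = 0"
    and p': "vnorm_wrt G p' \<le> a * vnorm_wrt G p"
    and bound: "(vnorm_wrt G (T *\<^sub>v (r + p')))\<^sup>2 \<le> a * (vnorm_wrt G r)\<^sup>2 + (vnorm_wrt G p')\<^sup>2"
    and bound_scaled: "(vnorm_wrt G (T *\<^sub>v (r + complex_of_real a \<cdot>\<^sub>v p)))\<^sup>2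
          \<le> a * (vnorm_wrt G r)\<^sup>2 + (vnorm_wrt G (complex_of_real a \<cdot>\<^sub>v p))\<^sup>2"
  shows "vnorm_wrt G (T *\<^sub>v (r + p')) \<le> a * vnorm_wrt G x"
proof -
  define K where "K = r + complex_of_real a \<cdot>\<^sub>v p"
  define q where "q = (vnorm_wrt G r)\<^sup>2 + a * (vnorm_wrt G p)\<^sup>2"
  have K: "K \<in> carrier_vec m" and TK: "T *\<^sub>v K \<in> carrier_vec m"
    using carrier T by (auto simp: K_def)
  have ap: "complex_of_real a \<cdot>\<^sub>v p \<in> carrier_vec m" and rp: "r + p \<in> carrier_vec m"
    and ax: "complex_of_real (- a) \<cdot>\<^sub>v x \<in> carrier_vec m"
    using carrier by auto
  have "inner_wrt G p r = 0"
    using orth inner_wrt_commute[OF G carrier(2,3)] by simp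
  then have "Re (inner_wrt G (T *\<^sub>v K) x) = q"
    unfolding adj[OF K] unfolding K_def q_def vnorm_wrt_sq[OF G carrier(2)] vnorm_wrt_sq[OF G carrier(3)]
      inner_wrt_add_left[OF G carrier(2) ap rp] inner_wrt_smult_left[OF G carrier(3) rp]
      inner_wrt_add_right[OF G carrier(2,2,3)] inner_wrt_add_right[OF G carrier(3,2,3)]
    using orth by simp
  \<comment> \<open>Used in place of the Cauchy--Schwarz inequality, which would require dividing by \<open>q\<close>.\<close>
  moreover have "0 \<le> (vnorm_wrt G (T *\<^sub>v K + complex_of_real (- a) \<cdot>\<^sub>v x))\<^sup>2"
    by simp
  ultimately have "0 \<le> (vnorm_wrt G (T *\<^sub>v K))\<^sup>2 + a\<^sup>2 * (vnorm_wrt G x)\<^sup>2 - 2 * (a * q)"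
    unfolding vnorm_wrt_sq_add[OF G TK ax] vnorm_wrt_sq_smult[OF G carrier(1)]
      inner_wrt_smult_right[OF G TK carrier(1)]
    by simp
  moreover have "(vnorm_wrt G (T *\<^sub>v K))\<^sup>2 \<le> a * q"
    using bound_scaled vnorm_wrt_sq_smult[OF G carrier(3), of a]
    by (simp add: K_def q_def power2_eq_square algebra_simps)
  ultimately have "a * q \<le> a\<^sup>2 * (vnorm_wrt G x)\<^sup>2" by simp
  moreover have "(vnorm_wrt G p')\<^sup>2 \<le> (a * vnorm_wrt G p)\<^sup>2"
    using p' inner_wrt_self_nonneg[OF G carrier(4)] by (intro power_mono) (auto simp: vnorm_wrt_def)
  ultimately have "(vnorm_wrt G (T *\<^sub>v (r + p')))\<^sup>2 \<le> (a * vnorm_wrt G x)\<^sup>2"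
    using bound by (simp add: q_def power2_eq_square algebra_simps)
  moreover have "0 \<le> a * vnorm_wrt G x"
    using a inner_wrt_self_nonneg[OF G carrier(1)] by (simp add: vnorm_wrt_def)
  ultimately show ?thesis by (rule power2_le_imp_le)
qed

text \<open>
  Every vector in the range of \<open>P\<close> has the form \<open>G\<^sup>-\<^sup>1 A\<^sup>H R v\<close>. The \<open>G\<close>-inner product cancels the inverse,
  and moving \<open>A\<^sup>H R\<close> to the other side leaves the restricted residual of \<open>r\<close> paired with \<open>v\<close>.
\<close>

lemma coarse_residual_orthogonal:
  assumes G: "hpd m G" and A: "A \<in> carrier_mat m m"
    and R: "R \<in> carrier_mat m c" and P: "P \<in> carrier_mat m c"
    and range: "vec_space.col_space m P = vec_space.col_space m (mat_inv G * mat_adjoint A * R)"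
    and r: "r \<in> carrier_vec m" and res: "mat_adjoint R *\<^sub>v (A *\<^sub>v r) = 0\<^sub>v c"
    and u: "u \<in> carrier_vec c"
  shows "inner_wrt G r (P *\<^sub>v u) = 0"
proof -
  interpret vec_space "TYPE(complex)" m .
  note G' = hpd_carrier[OF G] and I = hpd_mat_inv(1)[OF G] and A' = mat_adjoint_carrier[OF A]
  note IA = mult_carrier_mat[OF I A'] and W = mult_carrier_mat[OF mult_carrier_mat[OF I A'] R]
  have "P *\<^sub>v u \<in> col_space P" unfolding col_space_eq[OF P] using P u by auto
  then obtain v where v: "v \<in> carrier_vec c" and Pu: "P *\<^sub>v u = (mat_inv G * mat_adjoint A * R) *\<^sub>v v"
    unfolding range col_space_eq[OF W] using W by auto
  have Rv: "R *\<^sub>v v \<in> carrier_vec m" and Ar: "A *\<^sub>v r \<in> carrier_vec m" using R A v r by auto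
  define w where "w = mat_adjoint A *\<^sub>v (R *\<^sub>v v)"
  have w: "w \<in> carrier_vec m" and Iw: "mat_inv G *\<^sub>v w \<in> carrier_vec m"
    using A' Rv I by (auto simp: w_def)
  have "P *\<^sub>v u = mat_inv G *\<^sub>v w"
    unfolding Pu w_def assoc_mult_mat_vec[OF IA R v] assoc_mult_mat_vec[OF I A' Rv] ..
  then have "inner_wrt G r (P *\<^sub>v u) = r \<bullet>c (G *\<^sub>v (mat_inv G *\<^sub>v w))"
    unfolding inner_wrt_def
    using cscalar_prod_mat_adjoint[OF G' r Iw] hpd_adjoint[OF G] by metis
  also have "G *\<^sub>v (mat_inv G *\<^sub>v w) = w"
    using hpd_mat_inv(2)[OF G] assoc_mult_mat_vec[OF G' I w] one_mult_mat_vec[OF w] by metis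
  also have "r \<bullet>c w = (A *\<^sub>v r) \<bullet>c (R *\<^sub>v v)"
    unfolding w_def using cscalar_prod_mat_adjoint[OF A r Rv] by metis
  also have "\<dots> = (mat_adjoint R *\<^sub>v (A *\<^sub>v r)) \<bullet>c v"
    using cscalar_prod_mat_adjoint'[OF R v Ar] by metis
  finally show ?thesis unfolding res using v by simp
qed

text \<open>
  If \<open>R\<^sup>H A P y = 0\<close>, then \<open>P y\<close> is orthogonal to the range of \<open>P\<close>, in particular to itself.
\<close>

lemma coarse_matrix_trivial_kernel:
  assumes G: "hpd m G" and A: "A \<in> carrier_mat m m"
    and R: "R \<in> carrier_mat m c" and P: "P \<in> carrier_mat m c"
    and rank: "vec_space.rank m P = c"
    and range: "vec_space.col_space m P = vec_space.col_space m (mat_inv G * mat_adjoint A * R)"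
    and y: "y \<in> carrier_vec c" and zero: "(mat_adjoint R * A * P) *\<^sub>v y = 0\<^sub>v c"
  shows "y = 0\<^sub>v c"
proof -
  have Py: "P *\<^sub>v y \<in> carrier_vec m" using P y by simp
  have "mat_adjoint R *\<^sub>v (A *\<^sub>v (P *\<^sub>v y)) = 0\<^sub>v c"
    using zero assoc_mult_mat_vec[OF mult_carrier_mat[OF mat_adjoint_carrier[OF R] A] P y]
      assoc_mult_mat_vec[OF mat_adjoint_carrier[OF R] A Py] by metis
  then have "inner_wrt G (P *\<^sub>v y) (P *\<^sub>v y) = 0"
    using coarse_residual_orthogonal[OF G A R P range Py _ y] by simp
  then have "P *\<^sub>v y = 0\<^sub>v m" using inner_wrt_self_pos[OF G Py] by auto
  then show ?thesis using full_column_rank_trivial_kernel[OF P rank y] by simp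
qed

lemma inner_wrt_galerkin:
  assumes G: "G \<in> carrier_mat m m" and P: "P \<in> carrier_mat m c"
    and x: "x \<in> carrier_vec c" and y: "y \<in> carrier_vec c"
  shows "inner_wrt (mat_adjoint P * G * P) x y = inner_wrt G (P *\<^sub>v x) (P *\<^sub>v y)"
proof -
  have Px: "P *\<^sub>v x \<in> carrier_vec m" and GPx: "G *\<^sub>v (P *\<^sub>v x) \<in> carrier_vec m"
    using P G x by auto
  have "(mat_adjoint P * G * P) *\<^sub>v x = mat_adjoint P *\<^sub>v (G *\<^sub>v (P *\<^sub>v x))"
    using assoc_mult_mat_vec[OF mult_carrier_mat[OF mat_adjoint_carrier[OF P] G] P x]
      assoc_mult_mat_vec[OF mat_adjoint_carrier[OF P] G Px] by metis
  then show ?thesis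
    unfolding inner_wrt_def using cscalar_prod_mat_adjoint'[OF P y GPx] by metis
qed

lemma mat_adjoint_mult:
  assumes "(M :: complex mat) \<in> carrier_mat a b" "N \<in> carrier_mat b c"
  shows "mat_adjoint (M * N) = mat_adjoint N * mat_adjoint M"
proof (rule eq_matI)
  note [simp] = mat_adjoint_carrier[OF assms(1)] mat_adjoint_carrier[OF assms(2)]
  have MN: "M * N \<in> carrier_mat a c" using assms by simp
  show "dim_row (mat_adjoint (M * N)) = dim_row (mat_adjoint N * mat_adjoint M)"
    "dim_col (mat_adjoint (M * N)) = dim_col (mat_adjoint N * mat_adjoint M)"
    using mat_adjoint_carrier[OF MN] by (auto simp: carrier_matD[OF mat_adjoint_carrier[OF assms(1)]]
        carrier_matD[OF mat_adjoint_carrier[OF assms(2)]])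
  fix i j assume "i < dim_row (mat_adjoint N * mat_adjoint M)" "j < dim_col (mat_adjoint N * mat_adjoint M)"
  then have "i < c" "j < a"
    using carrier_matD[OF mat_adjoint_carrier[OF assms(1)]]
      carrier_matD[OF mat_adjoint_carrier[OF assms(2)]] by auto
  then show "mat_adjoint (M * N) $$ (i, j) = (mat_adjoint N * mat_adjoint M) $$ (i, j)"
    using assms carrier_matD[OF mat_adjoint_carrier[OF assms(1)]]
      carrier_matD[OF mat_adjoint_carrier[OF assms(2)]]
    by (auto simp: mat_adjoint_index[OF MN] mat_adjoint_index[OF assms(1)] mat_adjoint_index[OF assms(2)]
        scalar_prod_def mult.commute intro!: sum.cong)
qed

lemma hpd_galerkin:
  assumes G: "hpd m G" and P: "P \<in> carrier_mat m c" and rank: "vec_space.rank m P = c"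
  shows "hpd c (mat_adjoint P * G * P)"
  unfolding hpd_def
proof (intro conjI ballI impI)
  note G' = hpd_carrier[OF G] and P' = mat_adjoint_carrier[OF P]
  show "mat_adjoint P * G * P \<in> carrier_mat c c" by (rule mult_carrier_mat[OF mult_carrier_mat[OF P' G'] P])
  show "mat_adjoint (mat_adjoint P * G * P) = mat_adjoint P * G * P"
    unfolding mat_adjoint_mult[OF mult_carrier_mat[OF P' G'] P] mat_adjoint_mult[OF P' G']
      mat_adjoint_adjoint[OF P] hpd_adjoint[OF G] by (rule assoc_mult_mat[OF P' G' P, symmetric])
  fix x :: "complex vec" assume x: "x \<in> carrier_vec c" "x \<noteq> 0\<^sub>v c"
  then have "P *\<^sub>v x \<noteq> 0\<^sub>v m" using full_column_rank_trivial_kernel[OF P rank] by blast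
  then have "0 < Re (inner_wrt G (P *\<^sub>v x) (P *\<^sub>v x))"
    using inner_wrt_self_pos[OF G] P x by simp
  then show "0 < Re (((mat_adjoint P * G * P) *\<^sub>v x) \<bullet>c x)"
    using inner_wrt_galerkin[OF G' P x(1) x(1)] by (simp add: inner_wrt_def)
qed

section \<open>The hierarchy\<close>

context vcycle_hierarchy
begin

lemma level_dim_pos: "k \<le> L \<Longrightarrow> 0 < n k"
  using n_decreasing[of k] n_coarsest by (cases "k = L") auto

lemma A_carrier: "k \<le> L \<Longrightarrow> A k \<in> carrier_mat (n k) (n k)"
proof (induction k)
  case 0
  then show ?case using A_0 by simp
next
  case (Suc k)
  then have "k < L" by simp
  then show ?case
    unfolding A_Suc[OF \<open>k < L\<close>]
    using mult_carrier_mat[OF mult_carrier_mat[OF mat_adjoint_carrier[OF R_carrier] Suc.IH] P_carrier]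
    by simp
qed

lemma B_hpd: "k \<le> L \<Longrightarrow> hpd (n k) (B k)"
proof (induction k)
  case 0
  then show ?case using B_0 by simp
next
  case (Suc k)
  then show ?case using B_Suc[of k] hpd_galerkin[OF _ P_carrier P_full_rank, of k "B k"] by simp
qed

lemma coarse_matrix_inverse:
  assumes k: "k < L"
  shows "mat_inv (A (Suc k)) \<in> carrier_mat (n (Suc k)) (n (Suc k))"
    "A (Suc k) * mat_inv (A (Suc k)) = 1\<^sub>m (n (Suc k))"
    "mat_inv (A (Suc k)) * A (Suc k) = 1\<^sub>m (n (Suc k))"
proof -
  have "y = 0\<^sub>v (n (Suc k))"
    if "y \<in> carrier_vec (n (Suc k))" "A (Suc k) *\<^sub>v y = 0\<^sub>v (n (Suc k))" for y
    using coarse_matrix_trivial_kernel[OF B_hpd A_carrier R_carrier P_carrier P_full_rank range_P]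
      that k A_Suc[OF k] by simp
  then show "mat_inv (A (Suc k)) \<in> carrier_mat (n (Suc k)) (n (Suc k))"
    "A (Suc k) * mat_inv (A (Suc k)) = 1\<^sub>m (n (Suc k))"
    "mat_inv (A (Suc k)) * A (Suc k) = 1\<^sub>m (n (Suc k))"
    using mat_inv_of_trivial_kernel[OF A_carrier, of "Suc k"] k by auto
qed

lemma vcycle_err_carrier:
  "k \<le> L \<Longrightarrow> vcycle_err L n A B R P Minv k \<in> carrier_mat (n k) (n k)"
proof (induction k rule: inc_induct)
  case base
  then show ?case by (simp add: vcycle_err.simps)
next
  case (step k)
  have MA: "Minv k * A k \<in> carrier_mat (n k) (n k)"
    using Minv_carrier[of k] A_carrier[of k] step by simp
  have E: "1\<^sub>m (n (Suc k)) - vcycle_err L n A B R P Minv (Suc k) \<in> carrier_mat (n (Suc k)) (n (Suc k))"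
    using step.IH by (rule minus_carrier_mat)
  have G: "hpd (n k) (B k)" and A': "A k \<in> carrier_mat (n k) (n k)"
    using B_hpd A_carrier step.hyps by auto
  note k = \<open>k < L\<close>
  show ?case
    unfolding vcycle_err.simps[of _ _ _ _ _ _ _ k] if_P[OF k]
    by (rule mult_carrier_mat[OF mult_carrier_mat[OF minus_carrier_mat[OF adjoint_wrt_carrier[OF G MA]]
          minus_carrier_mat[OF mult_carrier_mat[OF mult_carrier_mat[OF mult_carrier_mat[OF
          mult_carrier_mat[OF P_carrier[OF k] E] coarse_matrix_inverse(1)[OF k]]
          mat_adjoint_carrier[OF R_carrier[OF k]]] A']]] minus_carrier_mat[OF MA]])
qed

lemma restrict_prolong:
  assumes k: "k < L" and u: "u \<in> carrier_vec (n (Suc k))"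
  shows "mat_adjoint (R k) *\<^sub>v (A k *\<^sub>v (P k *\<^sub>v u)) = A (Suc k) *\<^sub>v u"
proof -
  have A': "A k \<in> carrier_mat (n k) (n k)" using A_carrier k by simp
  note P' = P_carrier[OF k] and R' = mat_adjoint_carrier[OF R_carrier[OF k]]
  have Pu: "P k *\<^sub>v u \<in> carrier_vec (n k)" using P' u by simp
  show ?thesis
    unfolding A_Suc[OF k] assoc_mult_mat_vec[OF mult_carrier_mat[OF R' A'] P' u] assoc_mult_mat_vec[OF R' A' Pu] ..
qed

lemma coarse_proj_carrier:
  assumes k: "k < L"
  shows "coarse_proj A R P k \<in> carrier_mat (n k) (n k)"
  unfolding coarse_proj_def
  using mult_carrier_mat[OF mult_carrier_mat[OF mult_carrier_mat[OF P_carrier[OF k]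
    coarse_matrix_inverse(1)[OF k]] mat_adjoint_carrier[OF R_carrier[OF k]]] A_carrier] k by simp

lemma coarse_proj_apply:
  assumes k: "k < L" and z: "z \<in> carrier_vec (n k)"
  shows "coarse_proj A R P k *\<^sub>v z
    = P k *\<^sub>v (mat_inv (A (Suc k)) *\<^sub>v (mat_adjoint (R k) *\<^sub>v (A k *\<^sub>v z)))"
proof -
  have A': "A k \<in> carrier_mat (n k) (n k)" using A_carrier k by simp
  note P' = P_carrier[OF k] and R' = mat_adjoint_carrier[OF R_carrier[OF k]]
    and I = coarse_matrix_inverse(1)[OF k]
  note PI = mult_carrier_mat[OF P' I]
  have Az: "A k *\<^sub>v z \<in> carrier_vec (n k)" using A' z by simp
  then have RAz: "mat_adjoint (R k) *\<^sub>v (A k *\<^sub>v z) \<in> carrier_vec (n (Suc k))" using R' by simp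
  show ?thesis
    unfolding coarse_proj_def assoc_mult_mat_vec[OF mult_carrier_mat[OF PI R'] A' z]
      assoc_mult_mat_vec[OF PI R' Az] assoc_mult_mat_vec[OF P' I RAz] ..
qed

text \<open>
  On a sum of this form the projection reads off the two parts, which is how the smoothing
  hypothesis becomes a bound in terms of \<open>r\<close> and \<open>P u\<close>.
\<close>

lemma coarse_proj_split:
  assumes k: "k < L" and r: "r \<in> carrier_vec (n k)" and u: "u \<in> carrier_vec (n (Suc k))"
    and res: "mat_adjoint (R k) *\<^sub>v (A k *\<^sub>v r) = 0\<^sub>v (n (Suc k))"
  shows "coarse_proj A R P k *\<^sub>v (r + P k *\<^sub>v u) = P k *\<^sub>v u"
    and "(1\<^sub>m (n k) - coarse_proj A R P k) *\<^sub>v (r + P k *\<^sub>v u) = r"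
proof -
  have A': "A k \<in> carrier_mat (n k) (n k)" and A'': "A (Suc k) \<in> carrier_mat (n (Suc k)) (n (Suc k))"
    using A_carrier k by auto
  note P' = P_carrier[OF k] and R' = mat_adjoint_carrier[OF R_carrier[OF k]]
    and I = coarse_matrix_inverse(1)[OF k]
  have Pu: "P k *\<^sub>v u \<in> carrier_vec (n k)" and Au: "A (Suc k) *\<^sub>v u \<in> carrier_vec (n (Suc k))"
    using P' A'' u by auto
  then have s: "r + P k *\<^sub>v u \<in> carrier_vec (n k)" and Ar: "A k *\<^sub>v r \<in> carrier_vec (n k)"
    and APu: "A k *\<^sub>v (P k *\<^sub>v u) \<in> carrier_vec (n k)"
    using r A' by auto
  have "mat_adjoint (R k) *\<^sub>v (A k *\<^sub>v (r + P k *\<^sub>v u)) = A (Suc k) *\<^sub>v u"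
    unfolding mult_add_distrib_mat_vec[OF A' r Pu] mult_add_distrib_mat_vec[OF R' Ar APu] res
      restrict_prolong[OF k u]
    using Au by simp
  moreover have "mat_inv (A (Suc k)) *\<^sub>v (A (Suc k) *\<^sub>v u) = u"
    using assoc_mult_mat_vec[OF I A'' u] coarse_matrix_inverse(3)[OF k] one_mult_mat_vec[OF u] by metis
  ultimately show proj: "coarse_proj A R P k *\<^sub>v (r + P k *\<^sub>v u) = P k *\<^sub>v u"
    using coarse_proj_apply[OF k s] by metis
  show "(1\<^sub>m (n k) - coarse_proj A R P k) *\<^sub>v (r + P k *\<^sub>v u) = r"
    unfolding minus_mult_distrib_mat_vec[OF one_carrier_mat coarse_proj_carrier[OF k] s] proj
      one_mult_mat_vec[OF s]
    using r carrier_matD[OF P'] by (intro eq_vecI) auto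
qed

lemma vnorm_wrt_prolong:
  assumes "k < L" "u \<in> carrier_vec (n (Suc k))"
  shows "vnorm_wrt (B k) (P k *\<^sub>v u) = vnorm_wrt (B (Suc k)) u"
  using inner_wrt_galerkin[OF hpd_carrier[OF B_hpd] P_carrier] assms B_Suc by (simp add: vnorm_wrt_def)

text \<open>
  The coarse correction leaves the part \<open>z - P y\<close> untouched and acts on \<open>P y\<close> only, through the error
  matrix of the next level.
\<close>

lemma vcycle_err_apply:
  fixes k x
  defines "z \<equiv> (1\<^sub>m (n k) - Minv k * A k) *\<^sub>v x"
  defines "y \<equiv> mat_inv (A (Suc k)) *\<^sub>v (mat_adjoint (R k) *\<^sub>v (A k *\<^sub>v z))"
  assumes k: "k < L" and x: "x \<in> carrier_vec (n k)"
  shows "vcycle_err L n A B R P Minv k *\<^sub>v x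
    = (1\<^sub>m (n k) - adjoint_wrt (B k) (Minv k * A k)) *\<^sub>v
        (z - P k *\<^sub>v y + P k *\<^sub>v (vcycle_err L n A B R P Minv (Suc k) *\<^sub>v y))"
proof -
  let ?E = "vcycle_err L n A B R P Minv (Suc k)"
  let ?T = "1\<^sub>m (n k) - adjoint_wrt (B k) (Minv k * A k)"
  let ?F = "P k * (1\<^sub>m (n (Suc k)) - ?E) * mat_inv (A (Suc k)) * mat_adjoint (R k) * A k"
  let ?S = "1\<^sub>m (n k) - Minv k * A k"
  have E: "?E \<in> carrier_mat (n (Suc k)) (n (Suc k))" using vcycle_err_carrier k by simp
  have A': "A k \<in> carrier_mat (n k) (n k)" using A_carrier k by simp
  have MA: "Minv k * A k \<in> carrier_mat (n k) (n k)"
    using Minv_carrier[OF k] A' by simp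
  have T: "?T \<in> carrier_mat (n k) (n k)"
    using adjoint_wrt_carrier[OF B_hpd MA] k by (auto intro: minus_carrier_mat)
  have S: "?S \<in> carrier_mat (n k) (n k)" using MA by (auto intro: minus_carrier_mat)
  have IE: "1\<^sub>m (n (Suc k)) - ?E \<in> carrier_mat (n (Suc k)) (n (Suc k))"
    using E by (rule minus_carrier_mat)
  note c = P_carrier[OF k] mat_adjoint_carrier[OF R_carrier[OF k]] coarse_matrix_inverse(1)[OF k]
  note F1 = mult_carrier_mat[OF c(1) IE]
  note F2 = mult_carrier_mat[OF F1 c(3)]
  note F3 = mult_carrier_mat[OF F2 c(2)]
  note F4 = mult_carrier_mat[OF F3 A']
  have IF: "1\<^sub>m (n k) - ?F \<in> carrier_mat (n k) (n k)" using F4 by (rule minus_carrier_mat)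
  have z: "z \<in> carrier_vec (n k)" using S x by (simp add: z_def)
  have Az: "A k *\<^sub>v z \<in> carrier_vec (n k)" using A' z by simp
  have RAz: "mat_adjoint (R k) *\<^sub>v (A k *\<^sub>v z) \<in> carrier_vec (n (Suc k))" using c(2) Az by simp
  have y: "y \<in> carrier_vec (n (Suc k))" using c(3) RAz by (simp add: y_def)
  have Ey: "?E *\<^sub>v y \<in> carrier_vec (n (Suc k))" using E y by simp
  have Py: "P k *\<^sub>v y \<in> carrier_vec (n k)" and PEy: "P k *\<^sub>v (?E *\<^sub>v y) \<in> carrier_vec (n k)"
    using c(1) y Ey by auto
  have Fz: "?F *\<^sub>v z = P k *\<^sub>v y - P k *\<^sub>v (?E *\<^sub>v y)"
    unfolding assoc_mult_mat_vec[OF F3 A' z] assoc_mult_mat_vec[OF F2 c(2) Az]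
      assoc_mult_mat_vec[OF F1 c(3) RAz] y_def[symmetric] assoc_mult_mat_vec[OF c(1) IE y]
      minus_mult_distrib_mat_vec[OF one_carrier_mat E y] one_mult_mat_vec[OF y]
      mult_minus_distrib_mat_vec[OF c(1) y Ey] ..
  have "(1\<^sub>m (n k) - ?F) *\<^sub>v z = z - (P k *\<^sub>v y - P k *\<^sub>v (?E *\<^sub>v y))"
    unfolding minus_mult_distrib_mat_vec[OF one_carrier_mat F4 z] one_mult_mat_vec[OF z] Fz ..
  also have "\<dots> = z - P k *\<^sub>v y + P k *\<^sub>v (?E *\<^sub>v y)"
    using z carrier_matD[OF c(1)] by (intro eq_vecI) auto
  finally have mid: "(1\<^sub>m (n k) - ?F) *\<^sub>v z = z - P k *\<^sub>v y + P k *\<^sub>v (?E *\<^sub>v y)" .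
  have "vcycle_err L n A B R P Minv k *\<^sub>v x = (?T * (1\<^sub>m (n k) - ?F) * ?S) *\<^sub>v x"
    unfolding vcycle_err.simps[of _ _ _ _ _ _ _ k] if_P[OF k] ..
  also have "\<dots> = ?T *\<^sub>v ((1\<^sub>m (n k) - ?F) *\<^sub>v z)"
    unfolding assoc_mult_mat_vec[OF mult_carrier_mat[OF T IF] S x] z_def[symmetric]
      assoc_mult_mat_vec[OF T IF z] ..
  finally show ?thesis unfolding mid .
qed

text \<open>
  The recursion starts at the coarsest level, so the induction runs downwards from \<open>L\<close>, where the
  error matrix vanishes. The bound is propagated vector by vector rather than through \<^const>\<open>mnorm_wrt\<close>,
  because a bound on the supremum controls individual vectors only once the set is known to be bounded.
\<close>

lemma vcycle_err_contraction:
  assumes a: "0 \<le> a"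
    and smoothing: "\<And>k e. k < L \<Longrightarrow> e \<in> carrier_vec (n k) \<Longrightarrow>
      (vnorm_wrt (B k) ((1\<^sub>m (n k) - adjoint_wrt (B k) (Minv k * A k)) *\<^sub>v e))\<^sup>2
        \<le> a * (vnorm_wrt (B k) ((1\<^sub>m (n k) - coarse_proj A R P k) *\<^sub>v e))\<^sup>2
          + (vnorm_wrt (B k) (coarse_proj A R P k *\<^sub>v e))\<^sup>2"
    and "k \<le> L" and "x \<in> carrier_vec (n k)"
  shows "vnorm_wrt (B k) (vcycle_err L n A B R P Minv k *\<^sub>v x) \<le> a * vnorm_wrt (B k) x"
  using assms(3,4)
proof (induction k arbitrary: x rule: inc_induct)
  case base
  have "vcycle_err L n A B R P Minv L *\<^sub>v x = 0\<^sub>v (n L)"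
    using base by (subst vcycle_err.simps) auto
  then show ?case
    using a inner_wrt_self_nonneg[OF B_hpd base] hpd_carrier[OF B_hpd[of L]]
    by (simp add: vnorm_wrt_def inner_wrt_def)
next
  case (step k)
  note k = \<open>k < L\<close> and x = \<open>x \<in> carrier_vec (n k)\<close>
  let ?E = "vcycle_err L n A B R P Minv (Suc k)"
  let ?T = "1\<^sub>m (n k) - adjoint_wrt (B k) (Minv k * A k)"
  define z where "z = (1\<^sub>m (n k) - Minv k * A k) *\<^sub>v x"
  define y where "y = mat_inv (A (Suc k)) *\<^sub>v (mat_adjoint (R k) *\<^sub>v (A k *\<^sub>v z))"
  define r where "r = z - P k *\<^sub>v y"
  have G: "hpd (n k) (B k)" using B_hpd k by simp
  note c = P_carrier[OF k] mat_adjoint_carrier[OF R_carrier[OF k]] coarse_matrix_inverse(1)[OF k]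
  have A': "A k \<in> carrier_mat (n k) (n k)" and A'': "A (Suc k) \<in> carrier_mat (n (Suc k)) (n (Suc k))"
    using A_carrier k by auto
  have MA: "Minv k * A k \<in> carrier_mat (n k) (n k)" using Minv_carrier[OF k] A' by simp
  have T: "?T \<in> carrier_mat (n k) (n k)"
    using adjoint_wrt_carrier[OF G MA] by (rule minus_carrier_mat)
  have z: "z \<in> carrier_vec (n k)"
    unfolding z_def by (rule mult_mat_vec_carrier[OF minus_carrier_mat[OF MA] x])
  have Az: "A k *\<^sub>v z \<in> carrier_vec (n k)" using A' z by simp
  have RAz: "mat_adjoint (R k) *\<^sub>v (A k *\<^sub>v z) \<in> carrier_vec (n (Suc k))" using c(2) Az by simp
  have y: "y \<in> carrier_vec (n (Suc k))" using c RAz by (simp add: y_def)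
  have Py: "P k *\<^sub>v y \<in> carrier_vec (n k)" using c y by simp
  have APy: "A k *\<^sub>v (P k *\<^sub>v y) \<in> carrier_vec (n k)" using A' Py by simp
  have r: "r \<in> carrier_vec (n k)" using z Py by (simp add: r_def)
  have Ey: "?E *\<^sub>v y \<in> carrier_vec (n (Suc k))"
    using vcycle_err_carrier[of "Suc k"] k y by simp
  have "A (Suc k) *\<^sub>v y = mat_adjoint (R k) *\<^sub>v (A k *\<^sub>v z)"
    unfolding y_def
    using assoc_mult_mat_vec[OF A'' c(3) RAz] coarse_matrix_inverse(2)[OF k] one_mult_mat_vec[OF RAz] by metis
  then have res: "mat_adjoint (R k) *\<^sub>v (A k *\<^sub>v r) = 0\<^sub>v (n (Suc k))"
    unfolding r_def mult_minus_distrib_mat_vec[OF A' z Py] mult_minus_distrib_mat_vec[OF c(2) Az APy]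
      restrict_prolong[OF k y]
    using RAz by simp
  have bound: "(vnorm_wrt (B k) (?T *\<^sub>v (r + P k *\<^sub>v u)))\<^sup>2
      \<le> a * (vnorm_wrt (B k) r)\<^sup>2 + (vnorm_wrt (B k) (P k *\<^sub>v u))\<^sup>2"
    if u: "u \<in> carrier_vec (n (Suc k))" for u
  proof -
    have "r + P k *\<^sub>v u \<in> carrier_vec (n k)" using r c(1) u by simp
    from smoothing[OF k this] show ?thesis unfolding coarse_proj_split[OF k r u res] .
  qed
  have aPy: "complex_of_real a \<cdot>\<^sub>v (P k *\<^sub>v y) = P k *\<^sub>v (complex_of_real a \<cdot>\<^sub>v y)"
    using mult_mat_vec[OF c(1) y] by simp
  have "vnorm_wrt (B k) (?T *\<^sub>v (r + P k *\<^sub>v (?E *\<^sub>v y))) \<le> a * vnorm_wrt (B k) x"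
  proof (rule smoothed_contraction[OF G a T x r Py])
    show "P k *\<^sub>v (?E *\<^sub>v y) \<in> carrier_vec (n k)" using c Ey by simp
    have "r + P k *\<^sub>v y = z" using z carrier_matD[OF c(1)] by (intro eq_vecI) (auto simp: r_def)
    then show "inner_wrt (B k) (?T *\<^sub>v u) x = inner_wrt (B k) u (r + P k *\<^sub>v y)"
      if "u \<in> carrier_vec (n k)" for u
      using inner_wrt_one_minus_adjoint_wrt[OF G MA that x] by (simp add: z_def)
    show "inner_wrt (B k) r (P k *\<^sub>v y) = 0"
      using coarse_residual_orthogonal[OF G A' R_carrier[OF k] c(1) range_P[OF k] r res y] .
    show "vnorm_wrt (B k) (P k *\<^sub>v (?E *\<^sub>v y)) \<le> a * vnorm_wrt (B k) (P k *\<^sub>v y)"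
      using step.IH[OF y] vnorm_wrt_prolong[OF k y] vnorm_wrt_prolong[OF k Ey] by simp
    show "(vnorm_wrt (B k) (?T *\<^sub>v (r + complex_of_real a \<cdot>\<^sub>v (P k *\<^sub>v y))))\<^sup>2
        \<le> a * (vnorm_wrt (B k) r)\<^sup>2 + (vnorm_wrt (B k) (complex_of_real a \<cdot>\<^sub>v (P k *\<^sub>v y)))\<^sup>2"
      unfolding aPy using y by (intro bound) simp
  qed (rule bound[OF Ey])
  then show ?case
    unfolding vcycle_err_apply[OF k x] r_def y_def z_def .
qed

end

theorem theorem4p2:
  fixes L :: nat
    and n :: "nat \<Rightarrow> nat"
    and A B R P Minv :: "nat \<Rightarrow> complex mat"
    and \<alpha> :: real
  assumes "vcycle_hierarchy L n A B R P Minv"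
    and "0 \<le> \<alpha>" and "\<alpha> < 1"
    and "\<forall>k < L. \<forall>e \<in> carrier_vec (n k).
           (vnorm_wrt (B k) ((1\<^sub>m (n k) - adjoint_wrt (B k) (Minv k * A k)) *\<^sub>v e))\<^sup>2
             \<le> \<alpha> * (vnorm_wrt (B k) ((1\<^sub>m (n k) - coarse_proj A R P k) *\<^sub>v e))\<^sup>2
               + (vnorm_wrt (B k) (coarse_proj A R P k *\<^sub>v e))\<^sup>2"
  shows "\<forall>k \<le> L. mnorm_wrt (B k) (vcycle_err L n A B R P Minv k) \<le> \<alpha>"
proof (intro allI impI)
  interpret vcycle_hierarchy L n A B R P Minv by (rule assms(1))
  fix k assume k: "k \<le> L"
  show "mnorm_wrt (B k) (vcycle_err L n A B R P Minv k) \<le> \<alpha>"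
    using B_hpd[OF k] level_dim_pos[OF k]
  proof (rule mnorm_wrt_le)
    fix x :: "complex vec" assume "x \<in> carrier_vec (n k)"
    then show "vnorm_wrt (B k) (vcycle_err L n A B R P Minv k *\<^sub>v x) \<le> \<alpha> * vnorm_wrt (B k) x"
      using vcycle_err_contraction[OF assms(2) _ k] assms(4) by blast
  qed
qed

end
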